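(* Let $\epsilon>0$. For every instance of \textsc{L-Sided Pricing} on a simple graph in which $\mu_v\ge 3\ln(1/\epsilon)/\epsilon^2+1$ for all $v\in R$, the optimum revenue of the instance is at least $(1-2\epsilon)$ times the optimum value of the linear program (LP-Pricing).
   Context: An instance of \textsc{L-Sided Pricing} consists of a finite bipartite graph $G=(L\cup R,E)$ (each edge joins $L$ and $R$; simple means no parallel edges), a capacity $\mu_w\in\mathbb Z_{\ge 0}\cup\{\infty\}$ for every vertex $w$, and a budget $b_e\ge 0$ for every edge $e$. A feasible solution is a pair $(p,F)$ with $p:L\cup R\to\mathbb R_{\ge0}$, $p(v)=0$ for $v\in R$, $F\subseteq E$, $p(u)+p(v)\le b_e$ for every $e=uv\in F$, and every vertex $w$ incident to at most $\mu_w$ edges of $F$; its revenue is $\sum_{e=uv\in F}(p(u)+p(v))$. For $u\in L$ let $P_u=\{b_e:e\in E\text{ incident to }u\}$ and $\delta(w)$ the set of edges incident to $w$. (LP-Pricing) has variables $y_{u,p}\ge0$ for $u\in L$, $p\in P_u$, and $x_{e,p}\ge 0$ for each edge $e=uv$ ($u\in L$) and $p\in P_u$ with $p\le b_e$; it maximizes $\sum_{e=uv}\sum_{p\in P_u}p\,x_{e,p}$ subject to: $\sum_{p\in P_u}y_{u,p}=1$ for all $u\in L$; $\sum_{e\in\delta(u)}x_{e,p}\le \mu_u\,y_{u,p}$ for all $u\in L$, $p\in P_u$; $\sum_{e=uv\in\delta(v)}\sum_{p\in P_u}x_{e,p}\le\mu_v$ for all $v\in R$; $x_{e,p}\le y_{u,p}$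 for all $u\in L$, $e\in\delta(u)$, $p\in P_u$ with $p\le b_e$ (sums range only over defined variables). *)

theory Defs
  imports "HOL-Analysis.Analysis" "HOL-Library.Extended_Nat"
begin

text \<open>Edges carry their own names, so that parallel edges are possible in general and
  simplicity is a genuine property; an edge \<open>e\<close> joins \<open>lend e\<close> to \<open>rend e\<close>.\<close>

record ('v, 'e) pricing =
  lverts :: "'v set"
  rverts :: "'v set"
  edges :: "'e set"
  lend :: "'e \<Rightarrow> 'v"
  rend :: "'e \<Rightarrow> 'v"
  cap :: "'v \<Rightarrow> enat"
  budget :: "'e \<Rightarrow> real"

definition pricing_instance :: "('v, 'e) pricing \<Rightarrow> bool" where
  "pricing_instance I \<longleftrightarrow>
     finite (lverts I) \<and> finite (rverts I) \<and> finite (edges I) \<and>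
     lverts I \<inter> rverts I = {} \<and>
     (\<forall>e\<in>edges I. lend I e \<in> lverts I \<and> rend I e \<in> rverts I \<and> budget I e \<ge> 0)"

definition simple_instance :: "('v, 'e) pricing \<Rightarrow> bool" where
  "simple_instance I \<longleftrightarrow> inj_on (\<lambda>e. (lend I e, rend I e)) (edges I)"

definition incident :: "('v, 'e) pricing \<Rightarrow> 'v \<Rightarrow> 'e set" where
  "incident I w = {e \<in> edges I. lend I e = w \<or> rend I e = w}"

definition feasible :: "('v, 'e) pricing \<Rightarrow> ('v \<Rightarrow> real) \<Rightarrow> 'e set \<Rightarrow> bool" where
  "feasible I p F \<longleftrightarrow>
     (\<forall>w\<in>lverts I \<union> rverts I. p w \<ge> 0) \<and>
     (\<forall>v\<in>rverts I. p v = 0) \<and>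
     F \<subseteq> edges I \<and>
     (\<forall>e\<in>F. p (lend I e) + p (rend I e) \<le> budget I e) \<and>
     (\<forall>w\<in>lverts I \<union> rverts I. enat (card (F \<inter> incident I w)) \<le> cap I w)"

definition revenue :: "('v, 'e) pricing \<Rightarrow> ('v \<Rightarrow> real) \<Rightarrow> 'e set \<Rightarrow> real" where
  "revenue I p F = (\<Sum>e\<in>F. p (lend I e) + p (rend I e))"

definition prices :: "('v, 'e) pricing \<Rightarrow> 'v \<Rightarrow> real set" where
  "prices I u = budget I ` incident I u"

text \<open>The variable \<open>x e p\<close> of the linear program exists only for \<open>p \<in> edge_prices I e\<close>,
  and \<open>y u p\<close> only for \<open>u \<in> lverts I\<close> and \<open>p \<in> prices I u\<close>; values of the functions elsewhere
  are unconstrained and enter neither the constraints nor the objective.\<close>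

definition edge_prices :: "('v, 'e) pricing \<Rightarrow> 'e \<Rightarrow> real set" where
  "edge_prices I e = {p \<in> prices I (lend I e). p \<le> budget I e}"

text \<open>With \<open>cap I u = \<infinity>\<close> the capacity constraint at \<open>u\<close> is void: for \<open>y u p > 0\<close> its right-hand
  side is \<open>\<infinity>\<close>, and for \<open>y u p = 0\<close> it is \<open>\<infinity> * 0 = 0\<close>, but then all \<open>x e p\<close> in the sum
  vanish by the last constraint.\<close>

definition lp_feasible ::
  "('v, 'e) pricing \<Rightarrow> ('e \<Rightarrow> real \<Rightarrow> real) \<Rightarrow> ('v \<Rightarrow> real \<Rightarrow> real) \<Rightarrow> bool" where
  "lp_feasible I x y \<longleftrightarrow>
     (\<forall>u\<in>lverts I. \<forall>p\<in>prices I u. y u p \<ge> 0) \<and>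
     (\<forall>e\<in>edges I. \<forall>p\<in>edge_prices I e. x e p \<ge> 0) \<and>
     (\<forall>u\<in>lverts I. (\<Sum>p\<in>prices I u. y u p) = 1) \<and>
     (\<forall>u\<in>lverts I. \<forall>p\<in>prices I u.
        ereal (\<Sum>e | e \<in> incident I u \<and> p \<le> budget I e. x e p)
          \<le> ereal_of_enat (cap I u) * ereal (y u p)) \<and>
     (\<forall>v\<in>rverts I.
        ereal (\<Sum>e\<in>incident I v. \<Sum>p\<in>edge_prices I e. x e p) \<le> ereal_of_enat (cap I v)) \<and>
     (\<forall>u\<in>lverts I. \<forall>e\<in>incident I u. \<forall>p\<in>edge_prices I e. x e p \<le> y u p)"

definition lp_value :: "('v, 'e) pricing \<Rightarrow> ('e \<Rightarrow> real \<Rightarrow> real) \<Rightarrow> real" where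
  "lp_value I x = (\<Sum>e\<in>edges I. \<Sum>p\<in>edge_prices I e. p * x e p)"

definition is_maximum :: "real set \<Rightarrow> real \<Rightarrow> bool" where
  "is_maximum S z \<longleftrightarrow> z \<in> S \<and> (\<forall>s\<in>S. s \<le> z)"

definition optimum_revenue :: "('v, 'e) pricing \<Rightarrow> real \<Rightarrow> bool" where
  "optimum_revenue I r \<longleftrightarrow> is_maximum {revenue I p F | p F. feasible I p F} r"

definition lp_optimum :: "('v, 'e) pricing \<Rightarrow> real \<Rightarrow> bool" where
  "lp_optimum I z \<longleftrightarrow> is_maximum {lp_value I x | x y. lp_feasible I x y} z"

text \<open>A vertex of \<open>lverts I\<close> without incident edges makes the equality constraint
  \<open>0 = 1\<close>; apart from that the linear program is feasible and its optimum is attained, so that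
  \<open>lp_optimum I\<close> holds for exactly one value.\<close>

lemma is_maximum_unique: "is_maximum S a \<Longrightarrow> is_maximum S b \<Longrightarrow> a = b"
  unfolding is_maximum_def by (meson order_antisym)

lemma compact_box_fun2:
  fixes S :: "'a \<Rightarrow> 'b \<Rightarrow> real set"
  assumes "\<And>a b. compact (S a b)"
  shows "compact {f. \<forall>a b. f a b \<in> S a b}"
proof -
  have 1: "compact (PiE UNIV (S a))" for a
    using compactin_PiE[of "\<lambda>_. euclidean" UNIV "S a"] assms
    by (simp add: euclidean_product_topology)
  have "compact (PiE UNIV (\<lambda>a. PiE UNIV (S a)))"
    using compactin_PiE[of "\<lambda>_. euclidean" UNIV "\<lambda>a. PiE UNIV (S a)"] 1
    by (simp add: euclidean_product_topology)
  moreover have "PiE UNIV (\<lambda>a. PiE UNIV (S a)) = {f. \<forall>a b. f a b \<in> S a b}"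
    by (auto simp: PiE_def Pi_def)
  ultimately show ?thesis by simp
qed

lemma continuous_on_apply2:
  fixes g :: "'c::topological_space \<Rightarrow> 'a \<Rightarrow> 'b \<Rightarrow> real"
  assumes "continuous_on UNIV g"
  shows "continuous_on UNIV (\<lambda>z. g z a b)"
  using continuous_on_product_then_coordinatewise[OF continuous_on_product_then_coordinatewise[OF assms]] .

lemma lp_feasible_exists:
  assumes inst: "pricing_instance I"
    and ne: "\<And>u. u \<in> lverts I \<Longrightarrow> incident I u \<noteq> {}"
  shows "\<exists>x y. lp_feasible I x y"
proof -
  have fin: "finite (prices I u)" for u
    using inst by (auto simp: pricing_instance_def prices_def incident_def)
  have "lp_feasible I (\<lambda>_ _. 0) (\<lambda>u _. 1 / real (card (prices I u)))"
    unfolding lp_feasible_def using fin ne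
    by (auto simp: prices_def ereal_0_le_mult zero_ereal_def[symmetric])
  then show ?thesis by blast
qed

lemma lp_optimum_exists:
  fixes I :: "('b, 'a) pricing"
  assumes inst: "pricing_instance I"
    and ne: "\<And>u. u \<in> lverts I \<Longrightarrow> incident I u \<noteq> {}"
  shows "\<exists>z. lp_optimum I z"
proof -
  have fin: "finite (prices I u)" for u
    using inst by (auto simp: pricing_instance_def prices_def incident_def)
  have lr: "lend I e \<in> lverts I" "e \<in> incident I (lend I e)" if "e \<in> edges I" for e
    using inst that by (auto simp: pricing_instance_def incident_def)
  have ule: "lend I e = u \<and> e \<in> edges I" if "u \<in> lverts I" "e \<in> incident I u" for u e
    using inst that by (auto simp: pricing_instance_def incident_def)
  define X where "X e p = (if e \<in> edges I \<and> p \<in> edge_prices I e then {0..1::real} else {0})" for e p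
  define Y where "Y u p = (if u \<in> lverts I \<and> p \<in> prices I u then {0..1::real} else {0})" for u p
  define C where "C = {z::('a \<Rightarrow> real \<Rightarrow> real) \<times> ('b \<Rightarrow> real \<Rightarrow> real).
     (\<forall>u\<in>lverts I. (\<Sum>p\<in>prices I u. snd z u p) = 1) \<and>
     (\<forall>u\<in>lverts I. \<forall>p\<in>prices I u. \<forall>n. cap I u = enat n \<longrightarrow>
        (\<Sum>e | e \<in> incident I u \<and> p \<le> budget I e. fst z e p) \<le> real n * snd z u p) \<and>
     (\<forall>v\<in>rverts I. \<forall>n. cap I v = enat n \<longrightarrow>
        (\<Sum>e\<in>incident I v. \<Sum>p\<in>edge_prices I e. fst z e p) \<le> real n) \<and>
     (\<forall>u\<in>lverts I. \<forall>e\<in>incident I u. \<forall>p\<in>edge_prices I e. fst z e p \<le> snd z u p)}"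
  define K where "K = ({x. \<forall>e p. x e p \<in> X e p} \<times> {y. \<forall>u p. y u p \<in> Y u p}) \<inter> C"
  have cont: "continuous_on UNIV (\<lambda>z::('a \<Rightarrow> real \<Rightarrow> real) \<times> ('b \<Rightarrow> real \<Rightarrow> real). fst z a b)"
    "continuous_on UNIV (\<lambda>z::('a \<Rightarrow> real \<Rightarrow> real) \<times> ('b \<Rightarrow> real \<Rightarrow> real). snd z c d)" for a b c d
    by (intro continuous_on_apply2 continuous_intros)+
  have "closed C"
    unfolding C_def Ball_def
    by (intro closed_Collect_conj closed_Collect_all closed_Collect_imp
        closed_Collect_le closed_Collect_eq open_Collect_const continuous_intros cont)
  then have "compact K"
    unfolding K_def X_def Y_def
    by (intro compact_Int_closed compact_Times compact_box_fun2) auto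
  have capL: "ereal (\<Sum>e | e \<in> incident I u \<and> p \<le> budget I e. x e p)
          \<le> ereal_of_enat (cap I u) * ereal (y u p) \<longleftrightarrow>
       (\<forall>n. cap I u = enat n \<longrightarrow>
          (\<Sum>e | e \<in> incident I u \<and> p \<le> budget I e. x e p) \<le> real n * y u p)"
    if u: "u \<in> lverts I" and p: "p \<in> prices I u" and y: "y u p \<ge> 0"
      and xy: "\<forall>e\<in>incident I u. \<forall>p\<in>edge_prices I e. x e p \<le> y u p" for x :: "'a \<Rightarrow> real \<Rightarrow> real" and y u p
  proof (cases "cap I u")
    case (enat n)
    then show ?thesis by simp
  next
    case infinity
    have "(\<Sum>e | e \<in> incident I u \<and> p \<le> budget I e. x e p) \<le> 0" if "y u p = 0"
      using xy ule[OF u] p that by (intro sum_nonpos) (fastforce simp: edge_prices_def)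
    with infinity y show ?thesis by (cases "y u p = 0") auto
  qed
  have capR: "ereal s \<le> ereal_of_enat c \<longleftrightarrow> (\<forall>n. c = enat n \<longrightarrow> s \<le> real n)" for s c
    by (cases c) auto
  have inK: "\<exists>z\<in>K. lp_value I (fst z) = lp_value I x" if xy: "lp_feasible I x y" for x y
  proof -
    define x' where "x' e p = (if e \<in> edges I \<and> p \<in> edge_prices I e then x e p else 0)" for e p
    define y' where "y' u p = (if u \<in> lverts I \<and> p \<in> prices I u then y u p else 0)" for u p
    have y1: "y u p \<le> 1" if "u \<in> lverts I" "p \<in> prices I u" for u p
      using member_le_sum[of p "prices I u" "y u"] xy that fin
      by (auto simp: lp_feasible_def)
    have x1: "x e p \<le> 1" if "e \<in> edges I" "p \<in> edge_prices I e" for e p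
      using xy that lr y1 unfolding lp_feasible_def edge_prices_def
      by (smt (verit, best) mem_Collect_eq)
    have s1: "(\<Sum>e | e \<in> incident I u \<and> p \<le> budget I e. x' e p)
        = (\<Sum>e | e \<in> incident I u \<and> p \<le> budget I e. x e p)" if "u \<in> lverts I" "p \<in> prices I u" for u p
      using that ule by (intro sum.cong) (auto simp: x'_def edge_prices_def)
    have s2: "(\<Sum>e\<in>incident I v. \<Sum>p\<in>edge_prices I e. x' e p)
        = (\<Sum>e\<in>incident I v. \<Sum>p\<in>edge_prices I e. x e p)" for v
      by (intro sum.cong) (auto simp: x'_def incident_def)
    have sub: "p \<in> prices I u" if "u \<in> lverts I" "e \<in> incident I u" "p \<in> edge_prices I e" for u e p
      using that ule by (auto simp: edge_prices_def)
    have F: "\<forall>u\<in>lverts I. \<forall>p\<in>prices I u. y u p \<ge> 0"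
      "\<forall>e\<in>edges I. \<forall>p\<in>edge_prices I e. x e p \<ge> 0"
      "\<forall>u\<in>lverts I. (\<Sum>p\<in>prices I u. y u p) = 1"
      "\<forall>u\<in>lverts I. \<forall>p\<in>prices I u.
        ereal (\<Sum>e | e \<in> incident I u \<and> p \<le> budget I e. x e p)
          \<le> ereal_of_enat (cap I u) * ereal (y u p)"
      "\<forall>v\<in>rverts I.
        ereal (\<Sum>e\<in>incident I v. \<Sum>p\<in>edge_prices I e. x e p) \<le> ereal_of_enat (cap I v)"
      "\<forall>u\<in>lverts I. \<forall>e\<in>incident I u. \<forall>p\<in>edge_prices I e. x e p \<le> y u p"
      using xy unfolding lp_feasible_def by blast+
    have "(x', y') \<in> C"
      unfolding C_def mem_Collect_eq fst_conv snd_conv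
    proof (intro conjI ballI allI impI)
      fix u assume u: "u \<in> lverts I"
      show "(\<Sum>p\<in>prices I u. y' u p) = 1" using F(3) u by (simp add: y'_def)
      fix p n assume p: "p \<in> prices I u" and n: "cap I u = enat n"
      show "(\<Sum>e | e \<in> incident I u \<and> p \<le> budget I e. x' e p) \<le> real n * y' u p"
        using F(4) u p n by (force simp: s1 y'_def)
    next
      fix v n assume "v \<in> rverts I" "cap I v = enat n"
      then show "(\<Sum>e\<in>incident I v. \<Sum>p\<in>edge_prices I e. x' e p) \<le> real n"
        using F(5) by (force simp: s2)
    next
      fix u e p assume "u \<in> lverts I" "e \<in> incident I u" "p \<in> edge_prices I e"
      then show "x' e p \<le> y' u p" using F(6) ule sub by (auto simp: x'_def y'_def)
    qed
    moreover have "x' e p \<in> X e p" for e p using F(2) x1 by (auto simp: x'_def X_def)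
    moreover have "y' u p \<in> Y u p" for u p using F(1) y1 by (auto simp: y'_def Y_def)
    ultimately have "(x', y') \<in> K" by (simp add: K_def)
    moreover have "lp_value I x' = lp_value I x"
      unfolding lp_value_def by (intro sum.cong) (auto simp: x'_def)
    ultimately show ?thesis by force
  qed
  have Kfeas: "lp_feasible I (fst z) (snd z)" if z: "z \<in> K" for z
  proof -
    have y0: "snd z u p \<ge> 0" for u p
    proof -
      have "snd z u p \<in> Y u p" using z by (auto simp: K_def)
      then show ?thesis by (auto simp: Y_def split: if_splits)
    qed
    have x0: "fst z e p \<ge> 0" for e p
    proof -
      have "fst z e p \<in> X e p" using z by (auto simp: K_def)
      then show ?thesis by (auto simp: X_def split: if_splits)
    qed
    have zC: "z \<in> C" using z by (simp add: K_def)
    then have C: "\<forall>u\<in>lverts I. (\<Sum>p\<in>prices I u. snd z u p) = 1"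
      "\<forall>u\<in>lverts I. \<forall>p\<in>prices I u. \<forall>n. cap I u = enat n \<longrightarrow>
        (\<Sum>e | e \<in> incident I u \<and> p \<le> budget I e. fst z e p) \<le> real n * snd z u p"
      "\<forall>v\<in>rverts I. \<forall>n. cap I v = enat n \<longrightarrow>
        (\<Sum>e\<in>incident I v. \<Sum>p\<in>edge_prices I e. fst z e p) \<le> real n"
      "\<forall>u\<in>lverts I. \<forall>e\<in>incident I u. \<forall>p\<in>edge_prices I e. fst z e p \<le> snd z u p"
      unfolding C_def by blast+
    have "ereal (\<Sum>e | e \<in> incident I u \<and> p \<le> budget I e. fst z e p)
          \<le> ereal_of_enat (cap I u) * ereal (snd z u p)" if "u \<in> lverts I" "p \<in> prices I u" for u p
      using capL[of u p "snd z" "fst z"] that y0 C(2,4) by blast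
    then show ?thesis
      unfolding lp_feasible_def capR using x0 y0 C by blast
  qed
  have "K \<noteq> {}" using lp_feasible_exists[OF assms] inK by blast
  moreover have "continuous_on K (\<lambda>z. lp_value I (fst z))"
    unfolding lp_value_def
    by (rule continuous_on_subset[OF _ subset_UNIV]) (intro continuous_intros cont)
  ultimately obtain z where z: "z \<in> K" "\<forall>w\<in>K. lp_value I (fst w) \<le> lp_value I (fst z)"
    using continuous_attains_sup \<open>compact K\<close> by blast
  have "lp_optimum I (lp_value I (fst z))"
    unfolding lp_optimum_def is_maximum_def
  proof (intro conjI ballI)
    show "lp_value I (fst z) \<in> {lp_value I x |x y. lp_feasible I x y}"
      using Kfeas[OF z(1)] by blast
  next
    fix s assume "s \<in> {lp_value I x |x y. lp_feasible I x y}"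
    then show "s \<le> lp_value I (fst z)" using inK z(2) by force
  qed
  then show ?thesis ..
qed

end

theory Submission
  imports Defs
begin

text \<open>Round an LP solution: independently for each left vertex \<open>u\<close> draw a price \<open>p\<close> with
  probability \<open>y u p\<close> and, given \<open>p\<close>, a set of at most \<open>cap I u\<close> edges at \<open>u\<close> containing \<open>e\<close> with
  probability \<open>(1 - \<epsilon>) * x e p / y u p\<close>; such a set exists because the polytope of vectors in
  \<open>[0,1]\<^sup>n\<close> with coordinate sum at most an integer \<open>k\<close> is integral. Then drop an edge whenever its
  right end is overloaded. In a simple graph the other edges at that right end were drawn
  independently of \<open>e\<close>, so a Chernoff bound shows that \<open>e\<close> is dropped with probability at most
  \<open>\<epsilon>\<close>, and the expected revenue is at least \<open>(1 - \<epsilon>)\<^sup>2\<close> times the LP value.\<close>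

section \<open>Random sets of bounded size with prescribed marginals\<close>

text \<open>Marginals are linear in the weights, so a convex decomposition of the target vector
  carries over to the distributions.\<close>

lemma subset_distribution_convex:
  fixes z1 z2 z :: "'a \<Rightarrow> real"
  assumes c: "0 \<le> c" "c \<le> 1"
    and z: "\<And>a. a \<in> A \<Longrightarrow> z a = c * z1 a + (1 - c) * z2 a"
    and 1: "\<exists>l. (\<forall>S. 0 \<le> l S) \<and> sum l \<S> = 1 \<and> (\<forall>a\<in>A. (\<Sum>S\<in>\<S>. l S * of_bool (a \<in> S)) = z1 a)"
    and 2: "\<exists>l. (\<forall>S. 0 \<le> l S) \<and> sum l \<S> = 1 \<and> (\<forall>a\<in>A. (\<Sum>S\<in>\<S>. l S * of_bool (a \<in> S)) = z2 a)"
  shows "\<exists>l. (\<forall>S. 0 \<le> l S) \<and> sum l \<S> = 1 \<and> (\<forall>a\<in>A. (\<Sum>S\<in>\<S>. l S * of_bool (a \<in> S)) = z a)"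
proof -
  obtain l1 where l1: "\<And>S. 0 \<le> l1 S" "sum l1 \<S> = 1"
      "\<And>a. a \<in> A \<Longrightarrow> (\<Sum>S\<in>\<S>. l1 S * of_bool (a \<in> S)) = z1 a"
    using 1 by blast
  obtain l2 where l2: "\<And>S. 0 \<le> l2 S" "sum l2 \<S> = 1"
      "\<And>a. a \<in> A \<Longrightarrow> (\<Sum>S\<in>\<S>. l2 S * of_bool (a \<in> S)) = z2 a"
    using 2 by blast
  note l = l1 l2
  have "(\<Sum>S\<in>\<S>. (c * l1 S + (1 - c) * l2 S) * of_bool (a \<in> S)) = z a" if "a \<in> A" for a
  proof -
    have "(\<Sum>S\<in>\<S>. (c * l1 S + (1 - c) * l2 S) * of_bool (a \<in> S))
        = c * (\<Sum>S\<in>\<S>. l1 S * of_bool (a \<in> S)) + (1 - c) * (\<Sum>S\<in>\<S>. l2 S * of_bool (a \<in> S))"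
      by (simp only: sum_distrib_left distrib_right sum.distrib mult.assoc)
    then show ?thesis using l that z by simp
  qed
  moreover have "(\<Sum>S\<in>\<S>. c * l1 S + (1 - c) * l2 S) = 1"
    using l by (simp add: sum.distrib sum_distrib_left[symmetric])
  ultimately show ?thesis
    using c l by (intro exI[of _ "\<lambda>S. c * l1 S + (1 - c) * l2 S"]) auto
qed

text \<open>Induction on the number of fractional coordinates. A vector with such a coordinate is a
  convex combination of two admissible vectors with strictly fewer; a vector with none is the
  indicator of a set of at most \<open>k\<close> elements, and a point mass realises it.\<close>

lemma subset_distribution:
  fixes z :: "'a \<Rightarrow> real"
  assumes "finite A" "\<And>a. a \<in> A \<Longrightarrow> 0 \<le> z a \<and> z a \<le> 1" "sum z A \<le> real k"
  shows "\<exists>l. (\<forall>S. 0 \<le> l S) \<and> sum l {S. S \<subseteq> A \<and> card S \<le> k} = 1 \<and>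
    (\<forall>a\<in>A. (\<Sum>S | S \<subseteq> A \<and> card S \<le> k. l S * of_bool (a \<in> S)) = z a)"
  using assms(2,3)
proof (induction "card {a \<in> A. 0 < z a \<and> z a < 1}" arbitrary: z rule: less_induct)
  case (less z)
  let ?frac = "\<lambda>z. {a \<in> A. 0 < z a \<and> z a < 1}"
  note fin = \<open>finite A\<close>
  have IH: "\<exists>l. (\<forall>S. 0 \<le> l S) \<and> sum l {S. S \<subseteq> A \<and> card S \<le> k} = 1 \<and>
    (\<forall>a\<in>A. (\<Sum>S | S \<subseteq> A \<and> card S \<le> k. l S * of_bool (a \<in> S)) = z' a)"
    if "?frac z' \<subset> ?frac z" "\<And>a. a \<in> A \<Longrightarrow> 0 \<le> z' a \<and> z' a \<le> 1" "sum z' A \<le> real k" for z'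
    using that fin by (intro less.hyps psubset_card_mono) auto
  consider "?frac z = {}" | a where "?frac z = {a}"
    | a b where "a \<in> ?frac z" "b \<in> ?frac z" "a \<noteq> b"
    by blast
  then show ?case
  proof cases
    case 1
    define S0 where "S0 = {a \<in> A. z a = 1}"
    have z: "z a = of_bool (a \<in> S0)" if "a \<in> A" for a
      using 1 less.prems(1)[OF that] that by (force simp: S0_def)
    have "sum z A = (\<Sum>a\<in>A. of_bool (a \<in> S0))"
      using z by (rule sum.cong[OF refl])
    also have "\<dots> = real (card S0)"
      using fin by (simp add: S0_def Int_def conj_commute cong: conj_cong)
    finally have "sum z A = real (card S0)" .
    then have S0: "S0 \<in> {S. S \<subseteq> A \<and> card S \<le> k}"
      using less.prems(2) by (auto simp: S0_def)
    have fS: "finite {S. S \<subseteq> A \<and> card S \<le> k}" using fin by simp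
    have "(\<Sum>S | S \<subseteq> A \<and> card S \<le> k. of_bool (S = S0) * f S) = (f S0 :: real)" for f
      using S0 fS by (subst sum.remove[OF fS S0]) (auto intro!: sum.neutral)
    from this[of "\<lambda>_. 1"] this show ?thesis
      using z by (intro exI[of _ "\<lambda>S. of_bool (S = S0)"]) auto
  next
    case (2 a)
    then have a: "a \<in> A" "0 < z a" "z a < 1" by auto
    have int: "z b = of_bool (z b = 1)" if "b \<in> A - {a}" for b
    proof -
      have "b \<notin> ?frac z" using 2 that by blast
      then show ?thesis using less.prems(1)[of b] that by (auto simp: less_le)
    qed
    have "sum z (A - {a}) = (\<Sum>b\<in>A - {a}. of_bool (z b = 1))"
      using int by (rule sum.cong[OF refl])
    also have "\<dots> = real (card ((A - {a}) \<inter> {b. z b = 1}))"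
      using fin by simp
    finally obtain m :: nat where m: "sum z (A - {a}) = real m" by blast
    have sA: "sum z A = z a + real m"
      using m a fin by (simp add: sum.remove)
    \<comment> \<open>The coordinates other than \<open>a\<close> are 0 or 1 and sum to the integer
      \<open>m\<close>. Since \<open>k\<close> is an integer too, \<open>m < k\<close> leaves room
      to round \<open>z a\<close> up to 1.\<close>
    have mk: "real m + 1 \<le> real k"
    proof -
      have "real m < real k" using sA a less.prems(2) by linarith
      then have "Suc m \<le> k" by simp
      then show ?thesis by (metis of_nat_Suc of_nat_mono add.commute)
    qed
    have s: "sum (z(a := r)) A = r + real m" for r
      using a fin m by (simp add: sum.remove[of A a] cong: sum.cong_simp)
    show ?thesis
    proof (rule subset_distribution_convex[of "z a" A z "z(a := 1)" "z(a := 0)"])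
      show "z b = z a * (z(a := 1)) b + (1 - z a) * (z(a := 0)) b" if "b \<in> A" for b
        by (simp add: algebra_simps)
      have frac: "?frac (z(a := r)) \<subset> ?frac z" if "r = 0 \<or> r = 1" for r
        using a that by (auto simp: psubset_eq set_eq_iff)
      show "\<exists>l. (\<forall>S. 0 \<le> l S) \<and> sum l {S. S \<subseteq> A \<and> card S \<le> k} = 1 \<and>
          (\<forall>b\<in>A. (\<Sum>S | S \<subseteq> A \<and> card S \<le> k. l S * of_bool (b \<in> S)) = (z(a := 1)) b)"
        by (rule IH[OF frac]) (use s[of 1] mk less.prems(1) in auto)
      show "\<exists>l. (\<forall>S. 0 \<le> l S) \<and> sum l {S. S \<subseteq> A \<and> card S \<le> k} = 1 \<and>
          (\<forall>b\<in>A. (\<Sum>S | S \<subseteq> A \<and> card S \<le> k. l S * of_bool (b \<in> S)) = (z(a := 0)) b)"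
        by (rule IH[OF frac]) (use s[of 0] mk less.prems(1) in auto)
    qed (use a in auto)
  next
    case (3 a b)
    have ab: "a \<in> A" "b \<in> A" "0 < z a" "z a < 1" "0 < z b" "z b < 1" using 3 by auto
    \<comment> \<open>\<open>s\<close> is the largest amount that can move from \<open>b\<close> to
      \<open>a\<close> within [0,1], \<open>t\<close> the largest in the other direction. Either
      extreme move keeps the sum and makes one of the two coordinates integral.\<close>
    define s where "s = min (1 - z a) (z b)"
    define t where "t = min (z a) (1 - z b)"
    have st: "0 < s" "0 < t" using ab by (auto simp: s_def t_def)
    define z1 where "z1 = z(a := z a + s, b := z b - s)"
    define z2 where "z2 = z(a := z a - t, b := z b + t)"
    have sum: "sum (z(a := z a + r, b := z b - r)) A = sum z A" for r
      using ab 3 fin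
      by (simp add: sum.remove[of A a] sum.remove[of "A - {a}" b] cong: sum.cong_simp)
    have "sum z1 A = sum z A" "sum z2 A = sum z A"
      using sum[of s] sum[of "-t"] by (auto simp: z1_def z2_def)
    moreover have "?frac z1 \<subset> ?frac z"
    proof -
      have "z1 a = 1 \<or> z1 b = 0" using 3 by (auto simp: z1_def s_def min_def)
      then have "a \<notin> ?frac z1 \<or> b \<notin> ?frac z1" by auto
      moreover have "?frac z1 \<subseteq> ?frac z" using ab by (auto simp: z1_def)
      ultimately show ?thesis using 3 by blast
    qed
    moreover have "?frac z2 \<subset> ?frac z"
    proof -
      have "z2 a = 0 \<or> z2 b = 1" using 3 by (auto simp: z2_def t_def min_def)
      then have "a \<notin> ?frac z2 \<or> b \<notin> ?frac z2" by auto
      moreover have "?frac z2 \<subseteq> ?frac z" using ab by (auto simp: z2_def)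
      ultimately show ?thesis using 3 by blast
    qed
    moreover have "0 \<le> z1 c \<and> z1 c \<le> 1" "0 \<le> z2 c \<and> z2 c \<le> 1" if "c \<in> A" for c
      using less.prems(1)[OF that] ab st by (auto simp: z1_def z2_def s_def t_def)
    ultimately show ?thesis
    proof (intro subset_distribution_convex[of "t / (s + t)" A z z1 z2] IH)
      \<comment> \<open>The displacements \<open>s\<close> and \<open>- t\<close> cancel under the
        weights \<open>t / (s + t)\<close> and \<open>s / (s + t)\<close>.\<close>
      show "z c = t / (s + t) * z1 c + (1 - t / (s + t)) * z2 c" if "c \<in> A" for c
      proof -
        define d where "d = t / (s + t)"
        have "d * s = (1 - d) * t" using st by (simp add: d_def field_simps)
        then show ?thesis
          using 3 unfolding d_def[symmetric] by (auto simp: z1_def z2_def algebra_simps)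
      qed
    qed (use st less.prems(2) in auto)
  qed
qed

section \<open>Product expectations and a Chernoff estimate\<close>

text \<open>Independence of the coordinates under a product weight: the product of sums expands into
  a sum over all choice functions \<open>g\<close>.\<close>

lemma expectation_prod:
  fixes q h :: "'a \<Rightarrow> 'b \<Rightarrow> real"
  assumes "finite A" "\<And>a. a \<in> A \<Longrightarrow> finite (B a)"
  shows "(\<Sum>g\<in>PiE A B. (\<Prod>a\<in>A. q a (g a)) * (\<Prod>a\<in>A. h a (g a))) = (\<Prod>a\<in>A. \<Sum>b\<in>B a. q a b * h a b)"
  using prod_sum_PiE[OF assms, where f = "\<lambda>a b. q a b * h a b"] by (simp add: prod.distrib)

text \<open>The probabilistic method: extracts a single outcome from a bound on an
  expectation.\<close>

lemma exists_ge_weighted_average: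
  fixes w f :: "'a \<Rightarrow> real"
  assumes "\<And>a. a \<in> A \<Longrightarrow> 0 \<le> w a" "sum w A = 1" "c \<le> (\<Sum>a\<in>A. w a * f a)"
  shows "\<exists>a\<in>A. c \<le> f a"
proof (rule ccontr)
  assume "\<not> ?thesis"
  then have lt: "f a < c" if "a \<in> A" for a using that by force
  \<comment> \<open>A sum over an infinite set is 0 by convention, so total weight 1 forces
    finiteness.\<close>
  have fin: "finite A" using assms(2) by (metis sum.infinite zero_neq_one)
  obtain a where a: "a \<in> A" "0 < w a"
    using assms(1,2) by (metis order_le_imp_less_or_eq sum.neutral zero_neq_one)
  have "(\<Sum>a\<in>A. w a * f a) < (\<Sum>a\<in>A. w a * c)"
    using a lt assms(1) fin
    by (intro sum_strict_mono_ex1) (auto intro: mult_left_mono less_imp_le mult_strict_left_mono)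
  also have "\<dots> = c" using assms(2) by (simp add: sum_distrib_right[symmetric])
  finally show False using assms(3) by simp
qed

text \<open>The right side is the second-order Taylor polynomial at 0. Right minus left vanishes at
  0 and has the nonnegative derivative \<open>y\<^sup>2 / (1 - y)\<close>.\<close>

lemma ln_one_minus_le:
  fixes x :: real
  assumes "0 \<le> x" "x < 1"
  shows "ln (1 - x) \<le> - x - x\<^sup>2 / 2"
proof -
  let ?f = "\<lambda>x::real. - x - x\<^sup>2 / 2 - ln (1 - x)"
  have "?f 0 \<le> ?f x"
  proof (rule DERIV_nonneg_imp_nondecreasing[OF assms(1)])
    fix y assume y: "0 \<le> y" "y \<le> x"
    then have "y < 1" using assms by simp
    have "(?f has_real_derivative (- 1 - y + 1 / (1 - y))) (at y)"
      using \<open>y < 1\<close> by (auto intro!: derivative_eq_intros simp: field_simps)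
    moreover have "- 1 - y + 1 / (1 - y) = y\<^sup>2 / (1 - y)"
      using \<open>y < 1\<close> by (simp add: field_simps power2_eq_square)
    ultimately show "\<exists>d. (?f has_real_derivative d) (at y) \<and> 0 \<le> d"
      using \<open>y < 1\<close> by (intro exI[of _ "- 1 - y + 1 / (1 - y)"]) auto
  qed
  then show ?thesis by simp
qed

text \<open>By the logarithm bound the left side is at most
  \<open>exp (- real k * \<epsilon>\<^sup>2 / 2)\<close>, and the size of \<open>k\<close> makes
  this exponent at most \<open>3 / 2 * ln \<epsilon>\<close>, hence at most
  \<open>ln \<epsilon>\<close>.\<close>

lemma overload_bound:
  fixes \<epsilon> :: real
  assumes "0 < \<epsilon>" "\<epsilon> < 1" "3 * ln (1 / \<epsilon>) / \<epsilon>\<^sup>2 \<le> real k"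
  shows "(1 - \<epsilon>) ^ k * exp (\<epsilon> * real k) \<le> \<epsilon>"
proof -
  have "(1 - \<epsilon>) ^ k * exp (\<epsilon> * real k) = exp (real k * (ln (1 - \<epsilon>) + \<epsilon>))"
    using assms(2) by (simp add: exp_add distrib_left exp_of_nat_mult mult.commute)
  also have "\<dots> \<le> exp (real k * (- \<epsilon>\<^sup>2 / 2))"
    using ln_one_minus_le[of \<epsilon>] assms by (intro iffD2[OF exp_le_cancel_iff] mult_left_mono) auto
  also have "\<dots> \<le> exp (ln \<epsilon>)"
  proof -
    have "3 * ln (1 / \<epsilon>) \<le> real k * \<epsilon>\<^sup>2" using assms by (simp add: field_simps)
    moreover have "ln (1 / \<epsilon>) = - ln \<epsilon>" "ln \<epsilon> \<le> 0" using assms by (auto simp: ln_div)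
    ultimately have "real k * (- \<epsilon>\<^sup>2 / 2) \<le> ln \<epsilon>" by simp
    then show ?thesis by simp
  qed
  finally show ?thesis using assms by simp
qed

section \<open>Offers, pruning and feasibility\<close>

text \<open>The possible outcomes of the draw at \<open>u\<close>. The natural numbers
  \<open>k\<close> stand in for the capacities, which may be infinite.\<close>

definition offers :: "('v, 'e) pricing \<Rightarrow> ('v \<Rightarrow> nat) \<Rightarrow> 'v \<Rightarrow> (real \<times> 'e set) set" where
  "offers I k u = (SIGMA p:prices I u. {S. S \<subseteq> {e \<in> incident I u. p \<le> budget I e} \<and> card S \<le> k u})"

text \<open>The left end of \<open>e\<close> is left out, so the set depends only on draws at other
  vertices and is independent of the draw that decides whether \<open>e\<close> is selected.\<close>

definition rivals :: "('v, 'e) pricing \<Rightarrow> ('v \<Rightarrow> real \<times> 'e set) \<Rightarrow> 'e \<Rightarrow> 'v set" where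
  "rivals I g e = {u \<in> lverts I - {lend I e}. rend I e \<in> rend I ` snd (g u)}"

text \<open>The strict inequality reserves one unit of capacity for \<open>e\<close> itself. Rivals
  are counted before any pruning, so every edge is tested separately.\<close>

definition pruned :: "('v, 'e) pricing \<Rightarrow> ('v \<Rightarrow> nat) \<Rightarrow> ('v \<Rightarrow> real \<times> 'e set) \<Rightarrow> 'e set" where
  "pruned I k g = {e \<in> edges I. e \<in> snd (g (lend I e)) \<and> card (rivals I g e) < k (rend I e)}"

definition offer_price :: "('v, 'e) pricing \<Rightarrow> ('v \<Rightarrow> real \<times> 'e set) \<Rightarrow> 'v \<Rightarrow> real" where
  "offer_price I g w = (if w \<in> lverts I then fst (g w) else 0)"

context
  fixes I :: "('v, 'e) pricing"
  assumes inst: "pricing_instance I"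
begin

lemma finite_sets: "finite (lverts I)" "finite (rverts I)" "finite (edges I)"
  using inst by (auto simp: pricing_instance_def)

lemma edge_ends:
  assumes "e \<in> edges I"
  shows "lend I e \<in> lverts I" "rend I e \<in> rverts I" "rend I e \<notin> lverts I" "budget I e \<ge> 0"
    "e \<in> incident I (lend I e)" "e \<in> incident I (rend I e)"
  using inst assms by (auto simp: pricing_instance_def incident_def)

lemma incident_left: "u \<in> lverts I \<Longrightarrow> e \<in> incident I u \<longleftrightarrow> e \<in> edges I \<and> lend I e = u"
  using edge_ends by (auto simp: incident_def)

lemma incident_right: "v \<in> rverts I \<Longrightarrow> e \<in> incident I v \<longleftrightarrow> e \<in> edges I \<and> rend I e = v"
  using inst by (auto simp: incident_def pricing_instance_def)

lemma finite_incident: "finite (incident I w)"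
  using finite_sets by (simp add: incident_def)

lemma finite_prices: "finite (prices I u)" "finite (edge_prices I e)"
  using finite_incident by (auto simp: prices_def edge_prices_def)

lemma prices_nonneg: "p \<in> prices I u \<Longrightarrow> 0 \<le> p"
  using edge_ends by (auto simp: prices_def incident_def)

lemma finite_offers: "finite (offers I k u)"
  unfolding offers_def using finite_prices finite_incident by auto

lemma feasible_pruned:
  assumes simple: "simple_instance I"
    and g: "g \<in> PiE (lverts I) (offers I k)"
    and k: "\<And>w. w \<in> lverts I \<union> rverts I \<Longrightarrow> enat (k w) \<le> cap I w"
  shows "feasible I (offer_price I g) (pruned I k g)"
proof -
  have gu: "fst (g u) \<in> prices I u" "snd (g u) \<subseteq> {e \<in> incident I u. fst (g u) \<le> budget I e}"
    "card (snd (g u)) \<le> k u" if "u \<in> lverts I" for u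
    using PiE_mem[OF g that] by (auto simp: offers_def)
  have L: "card (pruned I k g \<inter> incident I u) \<le> k u" if u: "u \<in> lverts I" for u
  proof -
    have "pruned I k g \<inter> incident I u \<subseteq> snd (g u)"
      using incident_left[OF u] by (auto simp: pruned_def)
    moreover have "finite (snd (g u))"
      using gu(2)[OF u] finite_incident[of u] by (auto intro: finite_subset)
    ultimately show ?thesis using gu(3)[OF u] card_mono le_trans by blast
  qed
  have R: "card (pruned I k g \<inter> incident I v) \<le> k v" if v: "v \<in> rverts I" for v
  proof (cases "pruned I k g \<inter> incident I v = {}")
    case False
    then obtain e where e: "e \<in> pruned I k g" "e \<in> edges I" "rend I e = v"
      using incident_right[OF v] by auto
    \<comment> \<open>By simplicity the surviving edges at \<open>v\<close> have distinct left ends.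
      Each of these is the left end of \<open>e\<close> or a rival of \<open>e\<close>, and
      \<open>e\<close> has fewer than \<open>k v\<close> rivals because it survived.\<close>
    have "card (pruned I k g \<inter> incident I v) \<le> card (insert (lend I e) (rivals I g e))"
    proof (rule card_inj_on_le)
      show "inj_on (lend I) (pruned I k g \<inter> incident I v)"
        using simple incident_right[OF v] unfolding simple_instance_def inj_on_def by auto
      show "lend I ` (pruned I k g \<inter> incident I v) \<subseteq> insert (lend I e) (rivals I g e)"
        using incident_right[OF v] e edge_ends by (auto simp: pruned_def rivals_def image_iff) metis
      show "finite (insert (lend I e) (rivals I g e))"
        using finite_sets by (simp add: rivals_def)
    qed
    also have "\<dots> \<le> Suc (card (rivals I g e))" by (rule card_insert_le_m1) auto
    also have "\<dots> \<le> k v" using e by (auto simp: pruned_def)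
    finally show ?thesis .
  qed auto
  show ?thesis
    unfolding feasible_def
  proof (intro conjI ballI)
    fix w assume w: "w \<in> lverts I \<union> rverts I"
    show "0 \<le> offer_price I g w"
      using gu(1) prices_nonneg by (auto simp: offer_price_def)
    show "enat (card (pruned I k g \<inter> incident I w)) \<le> cap I w"
      using L R w k[OF w] by (meson UnE enat_ord_simps(1) order_trans)
  next
    fix e assume e: "e \<in> pruned I k g"
    then have "e \<in> edges I" "e \<in> snd (g (lend I e))" by (auto simp: pruned_def)
    then show "offer_price I g (lend I e) + offer_price I g (rend I e) \<le> budget I e"
      using edge_ends gu(2) by (force simp: offer_price_def)
  qed (use inst in \<open>auto simp: offer_price_def pricing_instance_def pruned_def\<close>)
qed

text \<open>The indicator of the event that edge \<open>e\<close> survives the pruning is bounded below by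
  \<open>1 - s ^ k * (1 / s) ^ card (rivals I g e)\<close>, whose expectation factorises over \<open>lverts I\<close>.\<close>

lemma revenue_pruned_ge:
  fixes s :: real
  assumes g: "g \<in> PiE (lverts I) (offers I k)" and s: "0 < s" "s \<le> 1"
  shows "(\<Sum>e\<in>edges I. \<Sum>p\<in>edge_prices I e. p * (of_bool (fst (g (lend I e)) = p \<and> e \<in> snd (g (lend I e))) *
      (1 - s ^ k (rend I e) * (\<Prod>u\<in>lverts I - {lend I e}. if rend I e \<in> rend I ` snd (g u) then 1 / s else 1))))
    \<le> revenue I (offer_price I g) (pruned I k g)"
proof -
  have prod: "(\<Prod>u\<in>lverts I - {lend I e}. if rend I e \<in> rend I ` snd (g u) then 1 / s else 1)
      = (1 / s) ^ card (rivals I g e)" for e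
    using finite_sets by (simp add: prod.If_cases rivals_def Int_def)
  have "(\<Sum>p\<in>edge_prices I e. p * (of_bool (fst (g (lend I e)) = p \<and> e \<in> snd (g (lend I e))) *
      (1 - s ^ k (rend I e) * (1 / s) ^ card (rivals I g e))))
    \<le> (if e \<in> pruned I k g then fst (g (lend I e)) else 0)" (is "?lhs \<le> ?rhs") if e: "e \<in> edges I" for e
  proof (cases "e \<in> snd (g (lend I e))")
    case True
    let ?p = "fst (g (lend I e))"
    let ?c = "1 - s ^ k (rend I e) * (1 / s) ^ card (rivals I g e)"
    have "g (lend I e) \<in> offers I k (lend I e)" using g edge_ends[OF e] by auto
    then have p: "?p \<in> edge_prices I e"
      using True by (auto simp: offers_def edge_prices_def)
    then have "0 \<le> ?p" using prices_nonneg by (auto simp: edge_prices_def)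
    have "?lhs = (\<Sum>p\<in>edge_prices I e. if p = ?p then ?p * ?c else 0)"
      using True by (intro sum.cong) auto
    also have "\<dots> = ?p * ?c" using p finite_prices by simp
    \<comment> \<open>A surviving edge needs only \<open>?c \<le> 1\<close>. A drawn edge that is
      pruned has at least \<open>k (rend I e)\<close> rivals, so the subtracted term is at least 1
      and \<open>?c \<le> 0\<close>.\<close>
    also have "\<dots> \<le> ?rhs"
    proof (cases "e \<in> pruned I k g")
      case True
      have "?c \<le> 1" using s by simp
      then show ?thesis using True \<open>0 \<le> ?p\<close> mult_left_mono[of ?c 1 ?p] by simp
    next
      case False
      then have "k (rend I e) \<le> card (rivals I g e)"
        using e \<open>e \<in> snd (g (lend I e))\<close> by (auto simp: pruned_def)
      then have "s ^ card (rivals I g e) \<le> s ^ k (rend I e)"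
        using s by (intro power_decreasing) auto
      then have "?c \<le> 0" using s by (simp add: field_simps)
      then show ?thesis using False \<open>0 \<le> ?p\<close> by (simp add: mult_nonneg_nonpos)
    qed
    finally show ?thesis .
  qed (auto simp: pruned_def)
  then have "(\<Sum>e\<in>edges I. \<Sum>p\<in>edge_prices I e. p * (of_bool (fst (g (lend I e)) = p \<and> e \<in> snd (g (lend I e))) *
      (1 - s ^ k (rend I e) * (1 / s) ^ card (rivals I g e))))
    \<le> (\<Sum>e\<in>edges I. if e \<in> pruned I k g then fst (g (lend I e)) else 0)"
    by (rule sum_mono)
  also have "\<dots> = (\<Sum>e\<in>edges I \<inter> pruned I k g. fst (g (lend I e)))"
    using finite_sets by (simp add: sum.inter_restrict)
  also have "edges I \<inter> pruned I k g = pruned I k g" by (auto simp: pruned_def)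
  also have "(\<Sum>e\<in>pruned I k g. fst (g (lend I e))) = revenue I (offer_price I g) (pruned I k g)"
    unfolding revenue_def
    by (rule sum.cong) (use edge_ends in \<open>auto simp: offer_price_def pruned_def\<close>)
  finally show ?thesis by (simp add: prod)
qed

section \<open>The random offers and their expected revenue\<close>

text \<open>Draw \<open>p\<close> with weight \<open>y p\<close> and then, by
  \<open>subset_distribution\<close>, a set with marginals \<open>s * x e p / y p\<close>. These lie
  in [0,1] because \<open>x e p \<le> y p\<close>, their sum is bounded by the capacity constraint,
  and \<open>y p\<close> cancels in the joint probability.\<close>

lemma offer_distribution:
  fixes s :: real
  assumes u: "u \<in> lverts I" and s: "0 \<le> s" "s \<le> 1"
    and y: "\<And>p. p \<in> prices I u \<Longrightarrow> 0 \<le> y p" "(\<Sum>p\<in>prices I u. y p) = 1"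
    and x: "\<And>e p. e \<in> incident I u \<Longrightarrow> p \<in> edge_prices I e \<Longrightarrow> 0 \<le> x e p \<and> x e p \<le> y p"
    and k: "\<And>p. p \<in> prices I u \<Longrightarrow> (\<Sum>e | e \<in> incident I u \<and> p \<le> budget I e. x e p) \<le> real (k u) * y p"
  shows "\<exists>q. (\<forall>o'\<in>offers I k u. 0 \<le> q o') \<and> sum q (offers I k u) = 1 \<and>
    (\<forall>e\<in>incident I u. \<forall>p\<in>edge_prices I e.
       (\<Sum>o'\<in>offers I k u. q o' * of_bool (fst o' = p \<and> e \<in> snd o')) = s * x e p)"
proof -
  let ?A = "\<lambda>p. {e \<in> incident I u. p \<le> budget I e}"
  let ?T = "\<lambda>p. {S. S \<subseteq> ?A p \<and> card S \<le> k u}"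
  have fT: "finite (?T p)" for p using finite_incident by auto
  have "\<exists>l. (\<forall>S. 0 \<le> l S) \<and> sum l (?T p) = 1 \<and>
      (\<forall>e\<in>?A p. (\<Sum>S\<in>?T p. l S * of_bool (e \<in> S)) = s * x e p / y p)" if p: "p \<in> prices I u" for p
  proof (rule subset_distribution)
    show "finite (?A p)" using finite_incident by simp
    have xe: "0 \<le> x e p \<and> x e p \<le> y p" if "e \<in> ?A p" for e
      using that p x[of e p] incident_left[OF u] by (auto simp: edge_prices_def)
    show "0 \<le> s * x e p / y p \<and> s * x e p / y p \<le> 1" if e: "e \<in> ?A p" for e
    proof -
      have "s * x e p \<le> 1 * y p" using xe[OF e] s by (intro mult_mono) auto
      then show ?thesis using xe[OF e] s y(1)[OF p] by (auto simp: divide_le_eq_1)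
    qed
    have "(\<Sum>e\<in>?A p. s * x e p / y p) = s * ((\<Sum>e\<in>?A p. x e p) / y p)"
      by (simp add: sum_distrib_left sum_divide_distrib)
    also have "\<dots> \<le> 1 * real (k u)"
    proof (rule mult_mono)
      \<comment> \<open>For \<open>y p = 0\<close> the quotient is 0 by the convention for
        division.\<close>
      show "(\<Sum>e\<in>?A p. x e p) / y p \<le> real (k u)"
        using k[OF p] y(1)[OF p] by (cases "y p = 0") (auto simp: field_simps)
      show "0 \<le> (\<Sum>e\<in>?A p. x e p) / y p"
        using xe y(1)[OF p] by (auto intro!: divide_nonneg_nonneg sum_nonneg)
    qed (use s in auto)
    finally show "(\<Sum>e\<in>?A p. s * x e p / y p) \<le> real (k u)" by simp
  qed
  then have "\<exists>l. \<forall>p\<in>prices I u. (\<forall>S. 0 \<le> l p S) \<and> sum (l p) (?T p) = 1 \<and>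
      (\<forall>e\<in>?A p. (\<Sum>S\<in>?T p. l p S * of_bool (e \<in> S)) = s * x e p / y p)"
    by (intro bchoice ballI)
  then obtain l where l: "\<And>p S. p \<in> prices I u \<Longrightarrow> 0 \<le> l p S"
      "\<And>p. p \<in> prices I u \<Longrightarrow> sum (l p) (?T p) = 1"
      "\<And>p e. p \<in> prices I u \<Longrightarrow> e \<in> ?A p \<Longrightarrow> (\<Sum>S\<in>?T p. l p S * of_bool (e \<in> S)) = s * x e p / y p"
    by blast
  let ?q = "\<lambda>(p, S). y p * l p S"
  have sum_offers: "(\<Sum>o'\<in>offers I k u. ?q o' * f (fst o') (snd o'))
      = (\<Sum>p\<in>prices I u. y p * (\<Sum>S\<in>?T p. l p S * f p S))" for f :: "real \<Rightarrow> 'e set \<Rightarrow> real"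
    unfolding offers_def using finite_prices fT
    by (simp add: sum.Sigma split_def sum_distrib_left mult.assoc)
  have "sum ?q (offers I k u) = 1"
    using sum_offers[of "\<lambda>_ _. 1"] l(2) y(2) by simp
  moreover have "(\<Sum>o'\<in>offers I k u. ?q o' * of_bool (fst o' = p \<and> e \<in> snd o')) = s * x e p"
    if e: "e \<in> incident I u" and p: "p \<in> edge_prices I e" for e p
  proof -
    have pu: "p \<in> prices I u" "e \<in> ?A p"
      using p e incident_left[OF u] by (auto simp: edge_prices_def)
    have "(\<Sum>o'\<in>offers I k u. ?q o' * of_bool (fst o' = p \<and> e \<in> snd o'))
        = (\<Sum>p'\<in>prices I u. if p' = p then y p * (\<Sum>S\<in>?T p. l p S * of_bool (e \<in> S)) else 0)"
      by (subst sum_offers) (auto intro!: sum.cong)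
    also have "\<dots> = y p * (s * x e p / y p)"
      using pu finite_prices l(3)[OF pu] by simp
    \<comment> \<open>For \<open>y p = 0\<close> the bounds \<open>0 \<le> x e p \<le> y p\<close>
      force \<open>x e p = 0\<close>, so the cancellation stays valid.\<close>
    also have "\<dots> = s * x e p" using x[OF e p] by auto
    finally show ?thesis .
  qed
  moreover have "\<forall>o'\<in>offers I k u. 0 \<le> ?q o'"
    using y(1) l(1) by (auto simp: offers_def)
  ultimately show ?thesis by blast
qed

text \<open>One factor of the moment generating function in the Chernoff bound. By the union bound
  \<open>v\<close> is hit with probability at most \<open>1 - \<epsilon>\<close> times the load that
  \<open>u\<close> puts on \<open>v\<close>; a hit adds \<open>\<epsilon> / (1 - \<epsilon>)\<close>
  to the factor 1, so \<open>1 - \<epsilon>\<close> cancels and \<open>1 + t \<le> exp t\<close>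
  finishes.\<close>

lemma expectation_hit_le:
  fixes \<epsilon> :: real
  assumes u: "u \<in> lverts I" and v: "v \<in> rverts I" and \<epsilon>: "0 < \<epsilon>" "\<epsilon> < 1"
    and q: "\<And>o'. o' \<in> offers I k u \<Longrightarrow> 0 \<le> q o'" "sum q (offers I k u) = 1"
    and marg: "\<And>e p. e \<in> incident I u \<Longrightarrow> p \<in> edge_prices I e \<Longrightarrow>
       (\<Sum>o'\<in>offers I k u. q o' * of_bool (fst o' = p \<and> e \<in> snd o')) = (1 - \<epsilon>) * x e p"
  shows "(\<Sum>o'\<in>offers I k u. q o' * (if v \<in> rend I ` snd o' then 1 / (1 - \<epsilon>) else 1))
    \<le> exp (\<epsilon> * (\<Sum>e\<in>{e \<in> incident I v. lend I e = u}. \<Sum>p\<in>edge_prices I e. x e p))"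
proof -
  let ?N = "{e \<in> incident I v. lend I e = u}"
  let ?O = "offers I k u"
  let ?b = "\<Sum>e\<in>?N. \<Sum>p\<in>edge_prices I e. x e p"
  have fN: "finite ?N" using finite_incident by simp
  have N: "e \<in> incident I u" if "e \<in> ?N" for e
    using that incident_left[OF u] incident_right[OF v] by auto
  have "(\<Sum>o'\<in>?O. q o' * of_bool (v \<in> rend I ` snd o'))
      \<le> (\<Sum>o'\<in>?O. \<Sum>e\<in>?N. \<Sum>p\<in>edge_prices I e. q o' * of_bool (fst o' = p \<and> e \<in> snd o'))"
  proof (rule sum_mono)
    fix o' assume o: "o' \<in> ?O"
    let ?f = "\<lambda>e p. q o' * of_bool (fst o' = p \<and> e \<in> snd o')"
    have nn: "0 \<le> ?f e p" for e p using q(1)[OF o] by simp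
    show "q o' * of_bool (v \<in> rend I ` snd o') \<le> (\<Sum>e\<in>?N. \<Sum>p\<in>edge_prices I e. ?f e p)"
    proof (cases "v \<in> rend I ` snd o'")
      case True
      then obtain e where e: "e \<in> snd o'" "rend I e = v" by auto
      then have eN: "e \<in> ?N" and p: "fst o' \<in> edge_prices I e"
        using o incident_left[OF u] incident_right[OF v] by (auto simp: offers_def edge_prices_def)
      have "q o' * of_bool (v \<in> rend I ` snd o') = ?f e (fst o')" using e True by simp
      also have "\<dots> \<le> (\<Sum>p\<in>edge_prices I e. ?f e p)"
        using p nn finite_prices by (intro member_le_sum[of _ _ "?f e"]) auto
      also have "\<dots> \<le> (\<Sum>e\<in>?N. \<Sum>p\<in>edge_prices I e. ?f e p)"
        using eN fN nn by (intro member_le_sum[of _ _ "\<lambda>e. \<Sum>p\<in>edge_prices I e. ?f e p"] sum_nonneg) auto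
      finally show ?thesis .
    next
      case False
      then show ?thesis using nn by (simp add: sum_nonneg)
    qed
  qed
  also have "\<dots> = (\<Sum>e\<in>?N. \<Sum>o'\<in>?O. \<Sum>p\<in>edge_prices I e. q o' * of_bool (fst o' = p \<and> e \<in> snd o'))"
    by (rule sum.swap)
  also have "\<dots> = (\<Sum>e\<in>?N. \<Sum>p\<in>edge_prices I e. \<Sum>o'\<in>?O. q o' * of_bool (fst o' = p \<and> e \<in> snd o'))"
    by (intro sum.cong refl sum.swap)
  also have "\<dots> = (\<Sum>e\<in>?N. \<Sum>p\<in>edge_prices I e. (1 - \<epsilon>) * x e p)"
    using marg N by (intro sum.cong refl) blast
  also have "\<dots> = (1 - \<epsilon>) * ?b" by (simp add: sum_distrib_left)
  finally have hit: "(\<Sum>o'\<in>?O. q o' * of_bool (v \<in> rend I ` snd o')) \<le> (1 - \<epsilon>) * ?b" .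
  have "(\<Sum>o'\<in>?O. q o' * (if v \<in> rend I ` snd o' then 1 / (1 - \<epsilon>) else 1))
      = (\<Sum>o'\<in>?O. q o' + \<epsilon> / (1 - \<epsilon>) * (q o' * of_bool (v \<in> rend I ` snd o')))"
    using \<epsilon> by (intro sum.cong refl) (auto simp: field_simps)
  also have "\<dots> = 1 + \<epsilon> / (1 - \<epsilon>) * (\<Sum>o'\<in>?O. q o' * of_bool (v \<in> rend I ` snd o'))"
    using q(2) by (simp only: sum.distrib sum_distrib_left)
  also have "\<dots> \<le> 1 + \<epsilon> / (1 - \<epsilon>) * ((1 - \<epsilon>) * ?b)"
    using \<epsilon> hit by (intro add_left_mono mult_left_mono) auto
  also have "\<dots> = 1 + \<epsilon> * ?b" using \<epsilon> by simp
  also have "\<dots> \<le> exp (\<epsilon> * ?b)" by (rule exp_ge_add_one_self)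
  finally show ?thesis .
qed

text \<open>The probabilistic argument for natural capacities \<open>k\<close>: every pair of an
  edge and a price keeps at least \<open>1 - 2 * \<epsilon>\<close> of its LP contribution in
  expectation, so some outcome does so in total.\<close>

lemma rounding:
  fixes \<epsilon> :: real
  assumes simple: "simple_instance I" and \<epsilon>: "0 < \<epsilon>" "\<epsilon> < 1"
    and cap: "\<And>w. w \<in> lverts I \<union> rverts I \<Longrightarrow> enat (k w) \<le> cap I w"
    and large: "\<And>v. v \<in> rverts I \<Longrightarrow> 3 * ln (1 / \<epsilon>) / \<epsilon>\<^sup>2 \<le> real (k v)"
    and y: "\<And>u p. u \<in> lverts I \<Longrightarrow> p \<in> prices I u \<Longrightarrow> 0 \<le> y u p"
      "\<And>u. u \<in> lverts I \<Longrightarrow> (\<Sum>p\<in>prices I u. y u p) = 1"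
    and x: "\<And>u e p. u \<in> lverts I \<Longrightarrow> e \<in> incident I u \<Longrightarrow> p \<in> edge_prices I e \<Longrightarrow> 0 \<le> x e p \<and> x e p \<le> y u p"
    and kL: "\<And>u p. u \<in> lverts I \<Longrightarrow> p \<in> prices I u \<Longrightarrow>
      (\<Sum>e | e \<in> incident I u \<and> p \<le> budget I e. x e p) \<le> real (k u) * y u p"
    and kR: "\<And>v. v \<in> rverts I \<Longrightarrow> (\<Sum>e\<in>incident I v. \<Sum>p\<in>edge_prices I e. x e p) \<le> real (k v)"
  shows "\<exists>p F. feasible I p F \<and> (1 - 2 * \<epsilon>) * lp_value I x \<le> revenue I p F"
proof -
  let ?L = "lverts I" and ?O = "offers I k"
  have "\<forall>u\<in>?L. \<exists>q. (\<forall>o'\<in>?O u. 0 \<le> q o') \<and> sum q (?O u) = 1 \<and>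
    (\<forall>e\<in>incident I u. \<forall>p\<in>edge_prices I e.
       (\<Sum>o'\<in>?O u. q o' * of_bool (fst o' = p \<and> e \<in> snd o')) = (1 - \<epsilon>) * x e p)"
  proof
    fix u assume u: "u \<in> ?L"
    show "\<exists>q. (\<forall>o'\<in>?O u. 0 \<le> q o') \<and> sum q (?O u) = 1 \<and>
      (\<forall>e\<in>incident I u. \<forall>p\<in>edge_prices I e.
         (\<Sum>o'\<in>?O u. q o' * of_bool (fst o' = p \<and> e \<in> snd o')) = (1 - \<epsilon>) * x e p)"
      using \<epsilon> offer_distribution[of u "1 - \<epsilon>" "y u" x k, OF u _ _ y(1)[OF u] y(2)[OF u] x[OF u] kL[OF u]]
      by (simp only: diff_ge_0_iff_ge diff_le_eq less_imp_le)
  qed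
  from bchoice[OF this] obtain q where q: "\<And>u o'. u \<in> ?L \<Longrightarrow> o' \<in> ?O u \<Longrightarrow> 0 \<le> q u o'"
      "\<And>u. u \<in> ?L \<Longrightarrow> sum (q u) (?O u) = 1"
      "\<And>u e p. u \<in> ?L \<Longrightarrow> e \<in> incident I u \<Longrightarrow> p \<in> edge_prices I e \<Longrightarrow>
       (\<Sum>o'\<in>?O u. q u o' * of_bool (fst o' = p \<and> e \<in> snd o')) = (1 - \<epsilon>) * x e p"
    by blast
  \<comment> \<open>The joint law of independent draws, one at each left vertex.\<close>
  define w where "w g = (\<Prod>u\<in>?L. q u (g u))" for g
  have fL: "finite ?L" by (rule finite_sets)
  have w0: "0 \<le> w g" if "g \<in> PiE ?L ?O" for g
    unfolding w_def using that by (intro prod_nonneg ballI q(1)) (auto simp: PiE_mem)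
  have w1: "sum w (PiE ?L ?O) = 1"
    unfolding w_def using prod_sum_PiE[OF fL, where B = ?O and f = q] finite_offers q(2) by simp
  let ?ind = "\<lambda>e p g. of_bool (fst (g (lend I e)) = p \<and> e \<in> snd (g (lend I e))) :: real"
  \<comment> \<open>This is \<open>(1 / (1 - \<epsilon>)) ^ card (rivals I g e)\<close>, written as
    a product over the draws so that independence applies.\<close>
  let ?H = "\<lambda>e g. \<Prod>u\<in>?L - {lend I e}. if rend I e \<in> rend I ` snd (g u) then 1 / (1 - \<epsilon>) else 1"
  let ?V = "\<lambda>g. \<Sum>e\<in>edges I. \<Sum>p\<in>edge_prices I e.
      p * (?ind e p g * (1 - (1 - \<epsilon>) ^ k (rend I e) * ?H e g))"
  have x0: "0 \<le> x e p" if "e \<in> edges I" "p \<in> edge_prices I e" for e p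
    using x edge_ends that by blast
  \<comment> \<open>The indicator reads only the draw at \<open>lend I e\<close> and the product
    only the other draws, so the expectation factorises.\<close>
  have expect: "(\<Sum>g\<in>PiE ?L ?O. w g * (?ind e p g * (\<Prod>u\<in>?L - {lend I e}. f (g u))))
      = (1 - \<epsilon>) * x e p * (\<Prod>u\<in>?L - {lend I e}. \<Sum>o'\<in>?O u. q u o' * f o')"
    if e: "e \<in> edges I" and p: "p \<in> edge_prices I e" for e p f
  proof -
    define h where "h u o' = (if u = lend I e then of_bool (fst o' = p \<and> e \<in> snd o') else f o')" for u o'
    have "?ind e p g * (\<Prod>u\<in>?L - {lend I e}. f (g u)) = (\<Prod>u\<in>?L. h u (g u))" for g
      using edge_ends[OF e] fL by (subst prod.remove[of _ "lend I e"]) (auto simp: h_def intro!: prod.cong)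
    then have "(\<Sum>g\<in>PiE ?L ?O. w g * (?ind e p g * (\<Prod>u\<in>?L - {lend I e}. f (g u))))
        = (\<Prod>u\<in>?L. \<Sum>o'\<in>?O u. q u o' * h u o')"
      unfolding w_def using expectation_prod[OF fL, of ?O q h] finite_offers by simp
    also have "\<dots> = (\<Sum>o'\<in>?O (lend I e). q (lend I e) o' * h (lend I e) o')
        * (\<Prod>u\<in>?L - {lend I e}. \<Sum>o'\<in>?O u. q u o' * h u o')"
      using edge_ends[OF e] fL by (intro prod.remove) auto
    also have "(\<Sum>o'\<in>?O (lend I e). q (lend I e) o' * h (lend I e) o') = (1 - \<epsilon>) * x e p"
      using q(3)[OF edge_ends(1,5)[OF e] p] by (simp add: h_def)
    also have "(\<Prod>u\<in>?L - {lend I e}. \<Sum>o'\<in>?O u. q u o' * h u o')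
        = (\<Prod>u\<in>?L - {lend I e}. \<Sum>o'\<in>?O u. q u o' * f o')"
      by (intro prod.cong refl) (auto simp: h_def)
    finally show ?thesis .
  qed
  \<comment> \<open>The bounds for the single vertices multiply to the exponential of
    \<open>\<epsilon>\<close> times a sum of loads. Grouping the edges at the right end of
    \<open>e\<close> by their left ends shows that this sum is at most the LP load there, hence at
    most \<open>k (rend I e)\<close>.\<close>
  have rivals_le: "(\<Prod>u\<in>?L - {lend I e}. \<Sum>o'\<in>?O u. q u o' * (if rend I e \<in> rend I ` snd o' then 1 / (1 - \<epsilon>) else 1))
      \<le> exp (\<epsilon> * real (k (rend I e)))" if e: "e \<in> edges I" for e
  proof -
    let ?v = "rend I e"
    let ?b = "\<lambda>u. \<Sum>e\<in>{e \<in> incident I ?v. lend I e = u}. \<Sum>p\<in>edge_prices I e. x e p"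
    have v: "?v \<in> rverts I" using edge_ends[OF e] by simp
    have b0: "0 \<le> ?b u" for u
      using x0 incident_right[OF v] by (auto intro!: sum_nonneg)
    have "(\<Prod>u\<in>?L - {lend I e}. \<Sum>o'\<in>?O u. q u o' * (if ?v \<in> rend I ` snd o' then 1 / (1 - \<epsilon>) else 1))
        \<le> (\<Prod>u\<in>?L - {lend I e}. exp (\<epsilon> * ?b u))"
      using q \<epsilon> v
      by (intro prod_mono conjI expectation_hit_le sum_nonneg mult_nonneg_nonneg) auto
    also have "\<dots> = exp (\<epsilon> * (\<Sum>u\<in>?L - {lend I e}. ?b u))"
      using fL by (simp add: exp_sum sum_distrib_left)
    also have "\<dots> \<le> exp (\<epsilon> * real (k ?v))"
    proof -
      have "(\<Sum>u\<in>?L - {lend I e}. ?b u) \<le> (\<Sum>u\<in>?L. ?b u)"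
        using fL b0 by (intro sum_mono2) auto
      also have "\<dots> = (\<Sum>e\<in>incident I ?v. \<Sum>p\<in>edge_prices I e. x e p)"
        using fL finite_incident incident_right[OF v] edge_ends by (intro sum.group) auto
      also have "\<dots> \<le> real (k ?v)" by (rule kR[OF v])
      finally show ?thesis using \<epsilon> by simp
    qed
    finally show ?thesis .
  qed
  have edge: "(1 - 2 * \<epsilon>) * x e p
      \<le> (\<Sum>g\<in>PiE ?L ?O. w g * (?ind e p g * (1 - (1 - \<epsilon>) ^ k (rend I e) * ?H e g)))"
    if e: "e \<in> edges I" and p: "p \<in> edge_prices I e" for e p
  proof -
    let ?s = "(1 - \<epsilon>) ^ k (rend I e)"
    let ?P = "\<Prod>u\<in>?L - {lend I e}. \<Sum>o'\<in>?O u. q u o' * (if rend I e \<in> rend I ` snd o' then 1 / (1 - \<epsilon>) else 1)"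
    have "?s * ?P \<le> ?s * exp (\<epsilon> * real (k (rend I e)))"
      using rivals_le[OF e] \<epsilon> by (intro mult_left_mono) auto
    also have "\<dots> \<le> \<epsilon>"
      using overload_bound[OF \<epsilon> large] edge_ends[OF e] by simp
    finally have sP: "?s * ?P \<le> \<epsilon>" .
    \<comment> \<open>Here \<open>(1 - \<epsilon>)\<^sup>2\<close> exceeds
      \<open>1 - 2 * \<epsilon>\<close> by \<open>\<epsilon>\<^sup>2\<close>. One factor is the
      scaling of the marginals, the other pays for overloading.\<close>
    have "(1 - 2 * \<epsilon>) * x e p \<le> (1 - \<epsilon>) * (1 - \<epsilon>) * x e p"
      using x0[OF e p] by (intro mult_right_mono) (auto simp: algebra_simps)
    also have "\<dots> = (1 - \<epsilon>) * x e p * (1 - \<epsilon>)" by simp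
    also have "\<dots> \<le> (1 - \<epsilon>) * x e p * (1 - ?s * ?P)"
      using sP \<epsilon> x0[OF e p] by (intro mult_left_mono) auto
    also have "\<dots> = (1 - \<epsilon>) * x e p - ?s * ((1 - \<epsilon>) * x e p * ?P)"
      by (simp only: right_diff_distrib mult_1_right mult.left_commute)
    also have "\<dots> = (\<Sum>g\<in>PiE ?L ?O. w g * ?ind e p g) - ?s * (\<Sum>g\<in>PiE ?L ?O. w g * (?ind e p g * ?H e g))"
    proof -
      have "(\<Sum>g\<in>PiE ?L ?O. w g * ?ind e p g) = (1 - \<epsilon>) * x e p"
        using expect[OF e p, of "\<lambda>_. 1"] q(2) by simp
      then show ?thesis
        using expect[OF e p, of "\<lambda>o'. if rend I e \<in> rend I ` snd o' then 1 / (1 - \<epsilon>) else 1"]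
        by (simp only:)
    qed
    also have "\<dots> = (\<Sum>g\<in>PiE ?L ?O. w g * ?ind e p g - ?s * (w g * (?ind e p g * ?H e g)))"
      by (simp only: sum_subtractf sum_distrib_left)
    also have "\<dots> = (\<Sum>g\<in>PiE ?L ?O. w g * (?ind e p g * (1 - ?s * ?H e g)))"
      by (intro sum.cong refl) (simp only: right_diff_distrib mult_1_right mult.left_commute)
    finally show ?thesis .
  qed
  have "(1 - 2 * \<epsilon>) * lp_value I x = (\<Sum>e\<in>edges I. \<Sum>p\<in>edge_prices I e. p * ((1 - 2 * \<epsilon>) * x e p))"
    unfolding lp_value_def by (simp only: sum_distrib_left mult.left_commute)
  also have "\<dots> \<le> (\<Sum>e\<in>edges I. \<Sum>p\<in>edge_prices I e. p *
      (\<Sum>g\<in>PiE ?L ?O. w g * (?ind e p g * (1 - (1 - \<epsilon>) ^ k (rend I e) * ?H e g))))"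
    using edge prices_nonneg by (intro sum_mono mult_left_mono) (auto simp: edge_prices_def)
  also have "\<dots> = (\<Sum>e\<in>edges I. \<Sum>p\<in>edge_prices I e. \<Sum>g\<in>PiE ?L ?O.
      w g * (p * (?ind e p g * (1 - (1 - \<epsilon>) ^ k (rend I e) * ?H e g))))"
    by (simp only: sum_distrib_left mult.left_commute)
  also have "\<dots> = (\<Sum>e\<in>edges I. \<Sum>g\<in>PiE ?L ?O. \<Sum>p\<in>edge_prices I e.
      w g * (p * (?ind e p g * (1 - (1 - \<epsilon>) ^ k (rend I e) * ?H e g))))"
    by (intro sum.cong refl sum.swap)
  also have "\<dots> = (\<Sum>g\<in>PiE ?L ?O. \<Sum>e\<in>edges I. \<Sum>p\<in>edge_prices I e.
      w g * (p * (?ind e p g * (1 - (1 - \<epsilon>) ^ k (rend I e) * ?H e g))))"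
    by (rule sum.swap)
  also have "\<dots> = (\<Sum>g\<in>PiE ?L ?O. w g * ?V g)"
    by (simp only: sum_distrib_left)
  finally obtain g where g: "g \<in> PiE ?L ?O" "(1 - 2 * \<epsilon>) * lp_value I x \<le> ?V g"
    using exists_ge_weighted_average[OF w0 w1, of _ ?V] by blast
  have "?V g \<le> revenue I (offer_price I g) (pruned I k g)"
    using \<epsilon> by (intro revenue_pruned_ge[OF g(1)]) auto
  then have "(1 - 2 * \<epsilon>) * lp_value I x \<le> revenue I (offer_price I g) (pruned I k g)"
    using g(2) by (rule order_trans[rotated])
  then show ?thesis using feasible_pruned[OF simple g(1) cap] by blast
qed

section \<open>Attainment of the optimum revenue\<close>

text \<open>Prices range over a continuum, but for a fixed edge set the best price at a left vertex
  is the smallest budget among its chosen edges. It remains to compare finitely many edge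
  sets.\<close>

lemma optimum_revenue_exists: "\<exists>opt. optimum_revenue I opt"
proof -
  \<comment> \<open>The default 0 covers right vertices and left vertices without chosen edges,
    where \<open>Min\<close> would meet an empty set.\<close>
  define best where "best F w = (if w \<in> lverts I \<and> F \<inter> incident I w \<noteq> {}
      then Min (budget I ` (F \<inter> incident I w)) else 0)" for F w
  have fin: "finite (budget I ` (F \<inter> incident I w))" for F w using finite_incident by auto
  have best_R: "best F v = 0" if "v \<in> rverts I" for F v
    using that inst by (auto simp: best_def pricing_instance_def)
  have better: "feasible I (best F) F \<and> revenue I p F \<le> revenue I (best F) F" if pF: "feasible I p F" for p F
  proof
    have F: "F \<subseteq> edges I" using pF by (simp add: feasible_def)
    have p_le: "p (lend I e) \<le> budget I e" if "e \<in> F" for e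
      using pF that F edge_ends(2) by (fastforce simp: feasible_def)
    have best_eq: "best F (lend I e) = Min (budget I ` (F \<inter> incident I (lend I e)))" if "e \<in> F" for e
      using that F edge_ends(1,5)[of e] by (auto simp: best_def)
    have "0 \<le> best F w" for w
      using fin by (auto simp: best_def incident_def intro!: Min.boundedI edge_ends(4))
    moreover have "best F (lend I e) + best F (rend I e) \<le> budget I e" if "e \<in> F" for e
    proof -
      have "best F (lend I e) \<le> budget I e"
        unfolding best_eq[OF that] using that F edge_ends(5) by (intro Min_le fin) auto
      then show ?thesis using best_R[OF edge_ends(2)] that F by auto
    qed
    ultimately show "feasible I (best F) F"
      using pF best_R by (auto simp: feasible_def)
    show "revenue I p F \<le> revenue I (best F) F"
      unfolding revenue_def
    proof (rule sum_mono)
      fix e assume e: "e \<in> F"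
      \<comment> \<open>As \<open>p\<close> vanishes on the right, its value at a left vertex is
        below the budget of every chosen edge there, hence below their minimum.\<close>
      have "p (lend I e) \<le> best F (lend I e)"
        unfolding best_eq[OF e]
      proof (rule Min.boundedI[OF fin])
        show "budget I ` (F \<inter> incident I (lend I e)) \<noteq> {}" using e F edge_ends(5) by auto
        fix c assume "c \<in> budget I ` (F \<inter> incident I (lend I e))"
        then obtain e' where e': "e' \<in> F" "e' \<in> incident I (lend I e)" "c = budget I e'" by auto
        then have "lend I e' = lend I e" using incident_left[OF edge_ends(1)] e F by blast
        then show "p (lend I e) \<le> c" using p_le[OF e'(1)] e'(3) by simp
      qed
      moreover have "p (rend I e) = 0" using pF e F edge_ends(2) by (auto simp: feasible_def)
      ultimately show "p (lend I e) + p (rend I e) \<le> best F (lend I e) + best F (rend I e)"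
        using best_R[OF edge_ends(2)] e F by auto
    qed
  qed
  define M where "M = (\<lambda>F. revenue I (best F) F) ` {F. feasible I (best F) F}"
  have "{F. feasible I (best F) F} \<subseteq> Pow (edges I)" by (auto simp: feasible_def)
  then have finM: "finite M" unfolding M_def using finite_sets by (meson finite_Pow_iff finite_imageI finite_subset)
  have "feasible I (\<lambda>_. 0) {}" by (auto simp: feasible_def zero_enat_def[symmetric])
  then have "M \<noteq> {}" using better by (auto simp: M_def)
  then have "Max M \<in> M" using finM by simp
  then have "optimum_revenue I (Max M)"
    unfolding optimum_revenue_def is_maximum_def
  proof (intro conjI ballI)
    fix r assume "r \<in> {revenue I p F |p F. feasible I p F}"
    then obtain p F where pF: "r = revenue I p F" "feasible I p F" by auto
    then have "revenue I (best F) F \<in> M" using better by (auto simp: M_def)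
    then show "r \<le> Max M" using better[OF pF(2)] pF(1) Max_ge[OF finM] by fastforce
  qed (auto simp: M_def)
  then show ?thesis ..
qed

section \<open>Infinite capacities and the final comparison\<close>

lemma feasible_revenue_ge:
  fixes \<epsilon> :: real
  assumes simple: "simple_instance I" and \<epsilon>: "0 < \<epsilon>" "\<epsilon> < 1"
    and large: "\<And>v. v \<in> rverts I \<Longrightarrow> ereal (3 * ln (1 / \<epsilon>) / \<epsilon>\<^sup>2) \<le> ereal_of_enat (cap I v)"
    and xy: "lp_feasible I x y"
  shows "\<exists>p F. feasible I p F \<and> (1 - 2 * \<epsilon>) * lp_value I x \<le> revenue I p F"
proof -
  let ?load = "\<lambda>v. \<Sum>e\<in>incident I v. \<Sum>p\<in>edge_prices I e. x e p"
  have F: "\<And>u p. u \<in> lverts I \<Longrightarrow> p \<in> prices I u \<Longrightarrow> y u p \<ge> 0"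
    "\<And>e p. e \<in> edges I \<Longrightarrow> p \<in> edge_prices I e \<Longrightarrow> x e p \<ge> 0"
    "\<And>u. u \<in> lverts I \<Longrightarrow> (\<Sum>p\<in>prices I u. y u p) = 1"
    "\<And>u p. u \<in> lverts I \<Longrightarrow> p \<in> prices I u \<Longrightarrow>
      ereal (\<Sum>e | e \<in> incident I u \<and> p \<le> budget I e. x e p) \<le> ereal_of_enat (cap I u) * ereal (y u p)"
    "\<And>v. v \<in> rverts I \<Longrightarrow> ereal (?load v) \<le> ereal_of_enat (cap I v)"
    "\<And>u e p. u \<in> lverts I \<Longrightarrow> e \<in> incident I u \<Longrightarrow> p \<in> edge_prices I e \<Longrightarrow> x e p \<le> y u p"
    using xy unfolding lp_feasible_def by blast+
  \<comment> \<open>An infinite capacity is replaced by a number that is at least the degree (for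
    the left LP constraint), the LP load (for the right one) and the Chernoff threshold.\<close>
  define k where "k w = (case cap I w of enat n \<Rightarrow> n
      | \<infinity> \<Rightarrow> max (card (incident I w)) (nat \<lceil>max (?load w) (3 * ln (1 / \<epsilon>) / \<epsilon>\<^sup>2)\<rceil>))" for w
  have k_inf: "real (card (incident I w)) \<le> real (k w)" "?load w \<le> real (k w)"
      "3 * ln (1 / \<epsilon>) / \<epsilon>\<^sup>2 \<le> real (k w)" if "cap I w = \<infinity>" for w
  proof -
    let ?c = "max (?load w) (3 * ln (1 / \<epsilon>) / \<epsilon>\<^sup>2)"
    have "?c \<le> real (nat \<lceil>?c\<rceil>)" by (rule real_nat_ceiling_ge)
    also have "\<dots> \<le> real (k w)" using that by (simp add: k_def)
    finally show "?load w \<le> real (k w)" "3 * ln (1 / \<epsilon>) / \<epsilon>\<^sup>2 \<le> real (k w)" by auto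
    show "real (card (incident I w)) \<le> real (k w)" using that by (simp add: k_def)
  qed
  have k_fin: "k w = n" if "cap I w = enat n" for w n using that by (simp add: k_def)
  show ?thesis
  proof (rule rounding[OF simple \<epsilon>, of k y x])
    show "enat (k w) \<le> cap I w" for w
      by (cases "cap I w") (auto simp: k_fin)
    show "3 * ln (1 / \<epsilon>) / \<epsilon>\<^sup>2 \<le> real (k v)" if "v \<in> rverts I" for v
      using large[OF that] k_inf k_fin by (cases "cap I v") auto
    show "?load v \<le> real (k v)" if "v \<in> rverts I" for v
      using F(5)[OF that] k_inf k_fin by (cases "cap I v") auto
    show "0 \<le> x e p \<and> x e p \<le> y u p"
      if "u \<in> lverts I" "e \<in> incident I u" "p \<in> edge_prices I e" for u e p
      using F(2,6) that incident_left by blast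
    show "(\<Sum>e | e \<in> incident I u \<and> p \<le> budget I e. x e p) \<le> real (k u) * y u p"
      if u: "u \<in> lverts I" and p: "p \<in> prices I u" for u p
    proof (cases "cap I u")
      case (enat n)
      then show ?thesis using F(4)[OF u p] k_fin by simp
    next
      case infinity
      let ?A = "{e. e \<in> incident I u \<and> p \<le> budget I e}"
      have "p \<in> edge_prices I e" if "e \<in> ?A" for e
        using that p incident_left[OF u] by (auto simp: edge_prices_def)
      \<comment> \<open>Since \<open>k u\<close> is at least the degree, summing
        \<open>x e p \<le> y u p\<close> over the edges yields the capacity constraint.\<close>
      then have "(\<Sum>e\<in>?A. x e p) \<le> (\<Sum>e\<in>?A. y u p)"
        using F(6)[OF u] by (intro sum_mono) auto
      also have "\<dots> = real (card ?A) * y u p" by simp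
      also have "\<dots> \<le> real (card (incident I u)) * y u p"
        using F(1)[OF u p] finite_incident by (intro mult_right_mono of_nat_mono card_mono) auto
      also have "\<dots> \<le> real (k u) * y u p"
        using F(1)[OF u p] k_inf(1)[OF infinity] by (intro mult_right_mono) auto
      finally show ?thesis .
    qed
  qed (use F in auto)
qed

end

theorem theorem13:
  fixes I :: "('v, 'e) pricing" and \<epsilon> :: real
  assumes "\<epsilon> > 0"
    and "pricing_instance I"
    and "simple_instance I"
    and "\<And>v. v \<in> rverts I \<Longrightarrow> ereal_of_enat (cap I v) \<ge> ereal (3 * ln (1 / \<epsilon>) / \<epsilon>\<^sup>2 + 1)"
  shows "\<exists>opt. optimum_revenue I opt \<and> (\<forall>lp. lp_optimum I lp \<longrightarrow> opt \<ge> (1 - 2 * \<epsilon>) * lp)"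
proof -
  obtain opt where opt: "optimum_revenue I opt"
    using optimum_revenue_exists[OF assms(2)] by blast
  then have opt_ge: "revenue I p F \<le> opt" if "feasible I p F" for p F
    using that unfolding optimum_revenue_def is_maximum_def by blast
  \<comment> \<open>The LP optimum is a maximum, hence itself the value of some feasible
    \<open>x\<close> and \<open>y\<close>.\<close>
  have "(1 - 2 * \<epsilon>) * lp_value I x \<le> opt" if xy: "lp_feasible I x y" for x y
  proof (cases "\<epsilon> < 1")
    case True
    have "ereal (3 * ln (1 / \<epsilon>) / \<epsilon>\<^sup>2) \<le> ereal_of_enat (cap I v)" if "v \<in> rverts I" for v
      by (rule order_trans[OF _ assms(4)[OF that]]) simp
    then show ?thesis
      using feasible_revenue_ge[OF assms(2,3,1) True _ xy] opt_ge order_trans by blast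
  next
    case False
    \<comment> \<open>For \<open>\<epsilon> \<ge> 1\<close> the factor
      \<open>1 - 2 * \<epsilon>\<close> is negative and the LP value is not, so the zero revenue of
      the empty selection suffices.\<close>
    have "0 \<le> lp_value I x"
      unfolding lp_value_def
      using xy prices_nonneg[OF assms(2)]
      by (intro sum_nonneg mult_nonneg_nonneg) (auto simp: lp_feasible_def edge_prices_def)
    then have "(1 - 2 * \<epsilon>) * lp_value I x \<le> 0"
      using False by (intro mult_nonpos_nonneg) auto
    also have "\<dots> = revenue I (\<lambda>_. 0) {}" by (simp add: revenue_def)
    also have "\<dots> \<le> opt"
      by (rule opt_ge) (auto simp: feasible_def zero_enat_def[symmetric])
    finally show ?thesis .
  qed
  then have "(1 - 2 * \<epsilon>) * lp \<le> opt" if "lp_optimum I lp" for lp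
    using that unfolding lp_optimum_def is_maximum_def by blast
  then show ?thesis using opt by blast
qed

end
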